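(* A topologically transitive dynamical system $(X,T)$ is absolutely moving recurrent if and only if it is uniformly rigid.
   Context: A dynamical system $(X,T)$ consists of a nonempty compact metric space $X$, with a fixed compatible metric $d$, and a homeomorphism $T$ of $X$ onto itself. It is topologically transitive if for every pair of nonempty open sets $U,V\subset X$ there is $n\in\mathbb{Z}$ with $T^nU\cap V\neq\emptyset$. $(X,T)$ is absolutely moving recurrent if for every infinite sequence $(n_k)_{k\ge1}$ of integers (i.e. any function $k\mapsto n_k$ from the positive integers to $\mathbb{Z}$) and every $x\in X$ one has $\psi_{(n_k)}(x)=0$, where $\psi_{(n_k)}(x)=\inf_{k\ge1} d(T^{n_k+k}x,T^{n_k}x)$. $(X,T)$ is uniformly rigid if there is a sequence of integers $m_i\nearrow\infty$ such that $\lim_{i\to\infty}\sup_{x\in X} d(x,T^{m_i}x)=0$. *)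

theory Defs
  imports "HOL-Analysis.Analysis"
begin

text \<open>The space is a carrier set \<open>X\<close> with the metric \<open>dist\<close> of the surrounding type, and open
  subsets of \<open>X\<close> are the relatively open ones. Values of \<open>T\<close> outside \<open>X\<close> are irrelevant.\<close>

definition dynamical_system :: "'a::metric_space set \<Rightarrow> ('a \<Rightarrow> 'a) \<Rightarrow> bool" where
  "dynamical_system X T \<longleftrightarrow> X \<noteq> {} \<and> compact X \<and> (\<exists>S. homeomorphism X X T S)"

text \<open>The \<open>n\<close>-th iterate for integer \<open>n\<close>. The inverse is taken relative to \<open>X\<close>, so this is \<open>T\<^sup>n\<close> on
  \<open>X\<close> whenever \<open>T\<close> is a bijection of \<open>X\<close>.\<close>

definition iterate :: "'a set \<Rightarrow> ('a \<Rightarrow> 'a) \<Rightarrow> int \<Rightarrow> 'a \<Rightarrow> 'a" where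
  "iterate X T n = (if 0 \<le> n then T ^^ nat n else inv_into X T ^^ nat (- n))"

definition topologically_transitive :: "'a::metric_space set \<Rightarrow> ('a \<Rightarrow> 'a) \<Rightarrow> bool" where
  "topologically_transitive X T \<longleftrightarrow>
     (\<forall>U V. openin (top_of_set X) U \<and> U \<noteq> {} \<and> openin (top_of_set X) V \<and> V \<noteq> {} \<longrightarrow>
        (\<exists>n::int. iterate X T n ` U \<inter> V \<noteq> {}))"

text \<open>Sequences are indexed by the positive integers; the value \<open>n 0\<close> is not used.\<close>

definition moving_psi ::
  "'a::metric_space set \<Rightarrow> ('a \<Rightarrow> 'a) \<Rightarrow> (nat \<Rightarrow> int) \<Rightarrow> 'a \<Rightarrow> real" where
  "moving_psi X T n x =
     (INF k\<in>{1..}. dist (iterate X T (n k + int k) x) (iterate X T (n k) x))"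

definition absolutely_moving_recurrent :: "'a::metric_space set \<Rightarrow> ('a \<Rightarrow> 'a) \<Rightarrow> bool" where
  "absolutely_moving_recurrent X T \<longleftrightarrow> (\<forall>n. \<forall>x\<in>X. moving_psi X T n x = 0)"

text \<open>The real supremum below is over a nonempty set, bounded because \<open>X\<close> is compact.\<close>

definition uniformly_rigid :: "'a::metric_space set \<Rightarrow> ('a \<Rightarrow> 'a) \<Rightarrow> bool" where
  "uniformly_rigid X T \<longleftrightarrow>
     (\<exists>m :: nat \<Rightarrow> int. mono m \<and> filterlim m at_top sequentially \<and>
        (\<lambda>i. SUP x\<in>X. dist x (iterate X T (m i) x)) \<longlonglongrightarrow> 0)"

end

theory Submission
  imports Defs
begin

text \<open>
  If \<open>d(T\<^sup>k x, x) \<le> \<delta>/N\<close> for all \<open>x\<close>, then \<open>d(T\<^sup>j x, x) \<le> \<delta>\<close> for all \<open>x\<close> with \<open>j = N k\<close>. Hence,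
  if the system is not uniformly rigid, there is \<open>\<epsilon> > 0\<close> such that
  \<open>U\<^sub>k = {x. d(T\<^sup>k x, x) > \<epsilon>}\<close> is a nonempty open set for every \<open>k \<ge> 1\<close>. By
  transitivity the points whose orbit meets \<open>U\<^sub>k\<close> form a dense open set, so by Baire there is a
  point \<open>x\<close> whose orbit meets all of them, say \<open>T\<^bsup>n\<^esup> x \<in> U\<^sub>k\<close> for \<open>n = n\<^sub>k\<close>. Then
  \<open>\<psi>(x) \<ge> \<epsilon>\<close> for this sequence.
\<close>

section \<open>Integer iterates as continuous self-maps of \<open>X\<close>\<close>

lemma dynamical_system_bij_betw:
  assumes "dynamical_system X T"
  shows "bij_betw T X X"
  using assms unfolding dynamical_system_def homeomorphism_def
  by (metis bij_betw_def inj_on_inverseI)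

lemma dynamical_system_continuous:
  assumes "dynamical_system X T"
  shows "continuous_on X T" "continuous_on X (inv_into X T)"
proof -
  obtain S where S: "homeomorphism X X T S"
    using assms by (auto simp: dynamical_system_def)
  then show "continuous_on X T"
    by (simp add: homeomorphism_def)
  \<comment> \<open>The two inverses may differ off \<open>X\<close>; agreement on \<open>X\<close>
    is enough to transfer continuity.\<close>
  have "inv_into X T y = S y" if "y \<in> X" for y
    using S that dynamical_system_bij_betw[OF assms]
    by (metis bij_betw_def homeomorphism_def image_eqI inv_into_f_eq)
  then show "continuous_on X (inv_into X T)"
    using S by (simp add: homeomorphism_def cong: continuous_on_cong)
qed

lemma funpow_mem:
  assumes "f ` X \<subseteq> X" "x \<in> X"
  shows "(f ^^ n) x \<in> X"
  using assms by (induction n) auto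

lemma continuous_on_funpow:
  assumes "continuous_on X f" "f ` X \<subseteq> X"
  shows "continuous_on X (f ^^ n)"
proof (induction n)
  case (Suc n)
  have "(f ^^ n) ` X \<subseteq> X"
    using funpow_mem[OF assms(2)] by auto
  then show ?case
    using continuous_on_compose[OF Suc continuous_on_subset[OF assms(1)]] by simp
qed (simp add: id_def)

lemma iterate_mem:
  assumes "dynamical_system X T" "x \<in> X"
  shows "iterate X T n x \<in> X"
  using dynamical_system_bij_betw[OF assms(1)] assms(2) bij_betw_inv_into[of T X X]
  by (auto simp: iterate_def bij_betw_def intro!: funpow_mem)

lemma continuous_on_iterate:
  assumes "dynamical_system X T"
  shows "continuous_on X (iterate X T n)"
  using dynamical_system_bij_betw[OF assms] dynamical_system_continuous[OF assms]
    bij_betw_inv_into[of T X X]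
  by (auto simp: iterate_def bij_betw_def intro!: continuous_on_funpow)

lemma iterate_of_nat [simp]: "iterate X T (int k) = T ^^ k"
  by (simp add: iterate_def)

lemma iterate_add_one:
  assumes "dynamical_system X T" "x \<in> X"
  shows "iterate X T (n + 1) x = T (iterate X T n x)"
proof (cases "0 \<le> n")
  case True
  then show ?thesis
    by (simp add: iterate_def nat_add_distrib)
next
  case False
  define m where "m = nat (- n - 1)"
  have n: "n = - int (Suc m)"
    using False by (simp add: m_def)
  have bij: "bij_betw T X X"
    by (rule dynamical_system_bij_betw) fact
  have "(inv_into X T ^^ m) x \<in> X"
    using bij_betw_inv_into[OF bij] assms(2) by (auto simp: bij_betw_def intro!: funpow_mem)
  then have "T ((inv_into X T ^^ Suc m) x) = (inv_into X T ^^ m) x"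
    using bij by (simp add: bij_betw_inv_into_right)
  moreover have "iterate X T n = inv_into X T ^^ Suc m"
    unfolding n iterate_def by (simp del: of_nat_Suc)
  \<comment> \<open>For \<open>m = 0\<close> the definition of \<open>iterate\<close> switches to
    its nonnegative branch; both sides are then the identity.\<close>
  moreover have "iterate X T (n + 1) = inv_into X T ^^ m"
    unfolding n iterate_def by auto
  ultimately show ?thesis
    by simp
qed

lemma iterate_add_of_nat:
  assumes "dynamical_system X T" "x \<in> X"
  shows "iterate X T (n + int k) x = (T ^^ k) (iterate X T n x)"
proof (induction k)
  case (Suc k)
  then show ?case
    using iterate_add_one[OF assms, of "n + int k"] by (simp add: algebra_simps)
qed simp

section \<open>Uniform rigidity implies moving recurrence\<close>

lemma moving_psi_nonneg: "0 \<le> moving_psi X T n x"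
  unfolding moving_psi_def by (rule cINF_greatest) auto

lemma moving_psi_le:
  assumes "1 \<le> k"
  shows "moving_psi X T n x \<le> dist (iterate X T (n k + int k) x) (iterate X T (n k) x)"
  unfolding moving_psi_def
  by (rule cINF_lower) (use assms in \<open>auto intro!: bdd_belowI2[where m = 0]\<close>)

lemma dist_le_SUP_dist_iterate:
  assumes "dynamical_system X T" "x \<in> X"
  shows "dist x (iterate X T n x) \<le> (SUP x\<in>X. dist x (iterate X T n x))"
proof (rule cSUP_upper)
  have "bounded X"
    using assms(1) by (simp add: dynamical_system_def compact_imp_bounded)
  then obtain B where "\<And>x y. x \<in> X \<Longrightarrow> y \<in> X \<Longrightarrow> dist x y \<le> B"
    by (meson bounded_two_points)
  then show "bdd_above ((\<lambda>x. dist x (iterate X T n x)) ` X)"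
    using iterate_mem[OF assms(1)] by (intro bdd_aboveI2[where M = B]) auto
qed fact

text \<open>The \<open>k\<close>-th term of the infimum is the displacement of the point
  \<open>y\<close>, the \<open>n k\<close>-th iterate of \<open>x\<close>, under the
  \<open>k\<close>-th power. For \<open>k = m i\<close> the supremum bounds it wherever
  \<open>y\<close> lies, so the choice of \<open>n\<close> cannot matter.\<close>

lemma uniformly_rigid_imp_absolutely_moving_recurrent:
  assumes "dynamical_system X T" "uniformly_rigid X T"
  shows "absolutely_moving_recurrent X T"
  unfolding absolutely_moving_recurrent_def
proof (intro allI ballI)
  fix n x
  assume "x \<in> X"
  obtain m where m: "filterlim m at_top sequentially"
    "(\<lambda>i. SUP x\<in>X. dist x (iterate X T (m i) x)) \<longlonglongrightarrow> 0"
    using assms(2) by (auto simp: uniformly_rigid_def)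
  have "moving_psi X T n x \<le> \<epsilon>" if "0 < \<epsilon>" for \<epsilon>
  proof -
    \<comment> \<open>Early values of \<open>m\<close> may be nonpositive, while the infimum runs
      over \<open>k \<ge> 1\<close>.\<close>
    have "\<forall>\<^sub>F i in sequentially. 1 \<le> m i \<and> (SUP x\<in>X. dist x (iterate X T (m i) x)) < \<epsilon>"
      using m that by (intro eventually_conj) (auto simp: filterlim_at_top order_tendsto_iff)
    then obtain i where i: "1 \<le> m i" "(SUP x\<in>X. dist x (iterate X T (m i) x)) < \<epsilon>"
      by (auto dest: eventually_happens'[rotated])
    define k where "k = nat (m i)"
    define y where "y = iterate X T (n k) x"
    have k: "m i = int k" "1 \<le> k"
      using i(1) by (simp_all add: k_def)
    have "moving_psi X T n x \<le> dist (iterate X T (n k + int k) x) y"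
      unfolding y_def by (rule moving_psi_le) fact
    also have "\<dots> = dist y (iterate X T (m i) y)"
      by (simp add: k y_def iterate_add_of_nat[OF assms(1) \<open>x \<in> X\<close>] dist_commute)
    also have "\<dots> \<le> (SUP x\<in>X. dist x (iterate X T (m i) x))"
      using assms(1) \<open>x \<in> X\<close> by (intro dist_le_SUP_dist_iterate) (simp_all add: y_def iterate_mem)
    finally show ?thesis
      using i(2) by simp
  qed
  then show "moving_psi X T n x = 0"
    using moving_psi_nonneg[of X T n x] by (metis field_le_epsilon add_0 order_antisym)
qed

section \<open>Moving recurrence and transitivity imply uniform rigidity\<close>

text \<open>Triangle inequality along \<open>j\<close> jumps of \<open>f ^^ k\<close>: each jump
  starts at a point of \<open>X\<close>, so costs at most \<open>\<delta>\<close>.\<close>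

lemma dist_funpow_mult_le:
  fixes f :: "'a::metric_space \<Rightarrow> 'a"
  assumes "f ` X \<subseteq> X" "x \<in> X" and "\<And>y. y \<in> X \<Longrightarrow> dist y ((f ^^ k) y) \<le> \<delta>"
  shows "dist x ((f ^^ (j * k)) x) \<le> real j * \<delta>"
proof (induction j)
  case (Suc j)
  let ?y = "(f ^^ (j * k)) x"
  have "dist x ((f ^^ (Suc j * k)) x) \<le> dist x ?y + dist ?y ((f ^^ k) ?y)"
    by (simp add: funpow_add dist_triangle)
  also have "\<dots> \<le> real j * \<delta> + \<delta>"
    using Suc assms by (intro add_mono) (simp_all add: funpow_mem)
  finally show ?case
    by (simp add: algebra_simps)
qed simp

lemma transitive_orbit_meets_open_sets:
  fixes U :: "nat \<Rightarrow> 'a::metric_space set"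
  assumes "dynamical_system X T" "topologically_transitive X T"
    and U: "\<And>k. openin (top_of_set X) (U k)" "\<And>k. U k \<noteq> {}"
  obtains x where "x \<in> X" "\<And>k. \<exists>n. iterate X T n x \<in> U k"
proof -
  define W where "W k = (\<Union>n. X \<inter> iterate X T n -` U k)" for k
  have op: "openin (top_of_set X) (W k)" for k
  proof -
    have pre: "openin (top_of_set X) (X \<inter> iterate X T n -` U k)" for n
    proof (rule continuous_openin_preimage[OF continuous_on_iterate[OF assms(1)] _ U(1)])
      show "iterate X T n \<in> X \<rightarrow> X"
        by (simp add: iterate_mem[OF assms(1)])
    qed
    have "openin (top_of_set X) S" if "S \<in> range (\<lambda>n. X \<inter> iterate X T n -` U k)" for S
      using that by (elim imageE) (simp add: pre)
    then show ?thesis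
      unfolding W_def by (rule openin_Union)
  qed
  have dense: "top_of_set X closure_of W k = topspace (top_of_set X)" for k
    unfolding dense_intersects_open
  proof (intro allI impI)
    fix V
    assume V: "openin (top_of_set X) V \<and> V \<noteq> {}"
    then have "\<exists>n. iterate X T n ` V \<inter> U k \<noteq> {}"
      using assms(2) U[of k] by (simp add: topologically_transitive_def)
    then obtain n y where "y \<in> V" "iterate X T n y \<in> U k"
      by auto
    moreover have "V \<subseteq> X"
      using V openin_imp_subset by blast
    ultimately show "W k \<inter> V \<noteq> {}"
      by (auto simp: W_def)
  qed
  have X: "compact X" "X \<noteq> {}"
    using assms(1) by (auto simp: dynamical_system_def)
  \<comment> \<open>Baire is applied in its locally compact regular form, with compactness of
    \<open>X\<close> as the source; the ambient type need not be complete.\<close>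
  have "regular_space (top_of_set X)"
    by (intro regular_space_subtopology regular_space_euclidean)
  moreover have "locally_compact_space (top_of_set X)"
    using X(1) by (intro compact_imp_locally_compact_space compact_space_subtopology) simp
  ultimately have "top_of_set X closure_of \<Inter>(range W) = topspace (top_of_set X)"
    by (intro Baire_category) (use op dense in auto)
  then have "\<Inter>(range W) \<noteq> {}"
    using X(2) by (metis closure_of_empty topspace_euclidean_subtopology)
  then obtain x where "\<And>k. x \<in> W k"
    by blast
  then show ?thesis
    by (intro that[of x]) (auto simp: W_def)
qed

lemma absolutely_moving_recurrent_imp_close_power:
  assumes "dynamical_system X T" "topologically_transitive X T"
    and "absolutely_moving_recurrent X T" "0 < \<epsilon>"
  obtains k where "1 \<le> k" "\<And>x. x \<in> X \<Longrightarrow> dist x ((T ^^ k) x) \<le> \<epsilon>"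
proof (rule ccontr)
  assume no: "\<not> thesis"
  \<comment> \<open>The shift to \<open>Suc k\<close> leaves out exponent 0, for which the set would
    be empty.\<close>
  define U where "U k = {x \<in> X. \<epsilon> < dist x ((T ^^ Suc k) x)}" for k
  have cont: "continuous_on X (\<lambda>x. dist x ((T ^^ k) x))" for k
    using continuous_on_iterate[OF assms(1), of "int k"] by (intro continuous_intros) simp
  have "openin (top_of_set X) (U k)" for k
  proof -
    have "U k = X \<inter> (\<lambda>x. dist x ((T ^^ Suc k) x)) -` {\<epsilon><..}"
      by (auto simp: U_def)
    then show ?thesis
      using continuous_openin_preimage_gen[OF cont open_greaterThan] by metis
  qed
  moreover have "U k \<noteq> {}" for k
    using no that[of "Suc k"] by (force simp: U_def)
  ultimately obtain x where "x \<in> X" "\<And>k. \<exists>n. iterate X T n x \<in> U k"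
    using transitive_orbit_meets_open_sets[OF assms(1,2)] by metis
  then obtain n where n: "\<And>k. iterate X T (n k) x \<in> U k"
    by metis
  \<comment> \<open>Undoes the shift: for \<open>k \<ge> 1\<close> the time \<open>n' k\<close>
    brings \<open>x\<close> to a point that \<open>T ^^ k\<close> moves by more than
    \<open>\<epsilon>\<close>.\<close>
  define n' where "n' k = n (k - 1)" for k
  have "\<epsilon> \<le> moving_psi X T n' x"
    unfolding moving_psi_def
  proof (rule cINF_greatest)
    fix k :: nat
    assume "k \<in> {1..}"
    then have "iterate X T (n' k) x \<in> U (k - 1)" "Suc (k - 1) = k"
      using n by (simp_all add: n'_def)
    then show "\<epsilon> \<le> dist (iterate X T (n' k + int k) x) (iterate X T (n' k) x)"
      unfolding iterate_add_of_nat[OF assms(1) \<open>x \<in> X\<close>] by (simp add: U_def dist_commute)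
  qed auto
  then show False
    using assms(3,4) \<open>x \<in> X\<close> by (auto simp: absolutely_moving_recurrent_def)
qed

lemma uniformly_rigidI:
  assumes "dynamical_system X T"
    and close: "\<And>\<epsilon> N. 0 < \<epsilon> \<Longrightarrow> \<exists>k\<ge>N. \<forall>x\<in>X. dist x ((T ^^ k) x) \<le> \<epsilon>"
  shows "uniformly_rigid X T"
proof -
  let ?P = "\<lambda>i k. \<forall>x\<in>X. dist x ((T ^^ k) x) \<le> inverse (real (Suc i))"
  \<comment> \<open>Since \<open>close\<close> offers arbitrarily large exponents, each choice can
    exceed the previous one; strict growth then gives divergence.\<close>
  have "\<exists>m. \<forall>i. ?P i (m i) \<and> m i < m (Suc i)"
  proof (rule dependent_nat_choice)
    show "\<exists>k. ?P 0 k"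
      using close[of "inverse (real (Suc 0))" 0] by auto
    show "\<exists>l. ?P (Suc i) l \<and> k < l" for k i
      using close[of "inverse (real (Suc (Suc i)))" "Suc k"] by (auto simp: Suc_le_eq)
  qed
  then obtain m where m: "\<And>i. ?P i (m i)" "strict_mono m"
    by (auto simp: strict_mono_Suc_iff)
  have "X \<noteq> {}"
    using assms(1) by (simp add: dynamical_system_def)
  let ?s = "\<lambda>i. SUP x\<in>X. dist x (iterate X T (int (m i)) x)"
  have "?s \<longlonglongrightarrow> 0"
  proof (rule tendsto_sandwich[OF _ _ tendsto_const LIMSEQ_inverse_real_of_nat])
    show "\<forall>\<^sub>F i in sequentially. 0 \<le> ?s i"
      using dist_le_SUP_dist_iterate[OF assms(1)] \<open>X \<noteq> {}\<close>
      by (intro always_eventually allI) (meson equals0I order_trans zero_le_dist)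
    show "\<forall>\<^sub>F i in sequentially. ?s i \<le> inverse (real (Suc i))"
      using m(1) \<open>X \<noteq> {}\<close> by (intro always_eventually allI cSUP_least) auto
  qed
  moreover have "mono (\<lambda>i. int (m i))"
    using strict_mono_mono[OF m(2)] by (simp add: mono_def)
  moreover have "filterlim (\<lambda>i. int (m i)) at_top sequentially"
    using filterlim_compose[OF filterlim_int_sequentially filterlim_subseq[OF m(2)]] .
  ultimately show ?thesis
    unfolding uniformly_rigid_def by blast
qed

text \<open>A close power alone may have a small exponent \<open>k\<close> for every tolerance, as
  for periodic \<open>T\<close>. Its multiple \<open>Suc N * k\<close> is at least \<open>N\<close>,
  and asking for tolerance \<open>\<epsilon> / Suc N\<close> at \<open>k\<close> pays for the
  \<open>Suc N\<close> jumps.\<close>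

lemma absolutely_moving_recurrent_imp_uniformly_rigid:
  assumes "dynamical_system X T" "topologically_transitive X T"
    and "absolutely_moving_recurrent X T"
  shows "uniformly_rigid X T"
proof (rule uniformly_rigidI)
  fix \<epsilon> :: real and N :: nat
  assume "0 < \<epsilon>"
  then have "0 < \<epsilon> / real (Suc N)"
    by simp
  then obtain k where k: "1 \<le> k" "\<And>x. x \<in> X \<Longrightarrow> dist x ((T ^^ k) x) \<le> \<epsilon> / real (Suc N)"
    using absolutely_moving_recurrent_imp_close_power[OF assms] by blast
  have "T ` X \<subseteq> X"
    using dynamical_system_bij_betw[OF assms(1)] by (simp add: bij_betw_def)
  then have "dist x ((T ^^ (Suc N * k)) x) \<le> real (Suc N) * (\<epsilon> / real (Suc N))" if "x \<in> X" for x
    using that k(2) by (rule dist_funpow_mult_le)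
  moreover have "real (Suc N) * (\<epsilon> / real (Suc N)) = \<epsilon>"
    by simp
  moreover have "N \<le> Suc N * k"
    using mult_le_mono[of N "Suc N" 1 k] k(1) by simp
  ultimately show "\<exists>k\<ge>N. \<forall>x\<in>X. dist x ((T ^^ k) x) \<le> \<epsilon>"
    by metis
qed fact

theorem theorem7p3:
  fixes X :: "'a::metric_space set" and T :: "'a \<Rightarrow> 'a"
  assumes "dynamical_system X T" and "topologically_transitive X T"
  shows "absolutely_moving_recurrent X T \<longleftrightarrow> uniformly_rigid X T"
  using absolutely_moving_recurrent_imp_uniformly_rigid[OF assms]
    uniformly_rigid_imp_absolutely_moving_recurrent[OF assms(1)]
  by blast

end
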